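(* Let $(g,\lambda,\varepsilon)$ be a real type, let $[\beta]_2,[\tilde\beta]_2\in\mathbb Z_2^g$ and let $\tau,\tilde\tau\in\mathcal H_{g,\lambda,\varepsilon}$. Assume that for some $G\in\mathbb G_{g,\lambda,\varepsilon}$ one has $$\tilde\tau=\mathfrak M(G,\tau)\quad\text{and}\quad[\tilde\beta]_2=\mathfrak A(G,[\beta]_2).$$ Then $$\Theta\left[\begin{smallmatrix}0\\ \tilde\beta\end{smallmatrix}\right](\tilde\tau)=\Theta\left[\begin{smallmatrix}0\\ \beta\end{smallmatrix}\right](\tau).$$
   Context: A real type is a triple of integers $(g,\lambda,\varepsilon)$ with $g\ge 1$, $\varepsilon\in\{0,1\}$, $0\le\lambda\le g$, $\lambda$ even if $\varepsilon=1$ and $\lambda\ge1$ if $\varepsilon=0$. Let $M=M_{g,\lambda,\varepsilon}$ be the $g\times g$ matrix $\begin{bmatrix} M_{\lambda,\lambda,\varepsilon}&0\\0&0\end{bmatrix}$, where $M_{\lambda,\lambda,1}=\begin{bmatrix}0&\mathrm{Id}_{\lambda/2}\\ \mathrm{Id}_{\lambda/2}&0\end{bmatrix}$ and $M_{\lambda,\lambda,0}=\mathrm{Id}_\lambda$. $\mathcal H_g$ is the Siegel upper half space of complex symmetric $g\times g$ matrices with positive definite imaginary part, and $\mathcal H_{g,\lambda,\varepsilon}=\{\tau\in\mathcal H_g: 2\,\mathrm{Re}(\tau)=M\}$. The real modular group is $$\mathbb G_{g,\lambda,\varepsilon}=\left\{G=\begin{bmatrix}A&\tfrac12(M-AMA^{\top})(A^{\top})^{-1}\\0&(A^{\top})^{-1}\end{bmatrix}: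 A\in \mathrm{GL}(g,\mathbb Z),\ M\equiv AMA^{\top}\bmod 2\right\}.$$ It acts on $\mathcal H_{g,\lambda,\varepsilon}$ by $\mathfrak M(G,\tau)=A\tau A^{\top}+\tfrac12(M-AMA^{\top})$, and on $\mathbb Z_2^g$ by $\mathfrak A(G,[\beta]_2)=[A\beta-\tfrac12\mathrm{diag}(M-AMA^{\top})]_2$, where $\mathrm{diag}(\cdot)$ is the vector of diagonal entries and $[\cdot]_2$ is the class modulo 2. For $\beta\in\mathbb Z^g$ the theta constant is $\Theta\left[\begin{smallmatrix}0\\ \beta\end{smallmatrix}\right](\tau)=\sum_{m\in\mathbb Z^g}\exp(\pi i\, m^{\top}\tau m+\pi i\,\beta^{\top}m)$; it depends only on $[\beta]_2$. *)

theory Defs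
  imports
    "Jordan_Normal_Form.Matrix"
    "HOL-Analysis.Infinite_Sum"
    "HOL-Library.Z2"
    "HOL-Number_Theory.Cong"
begin

definition real_type :: "nat \<Rightarrow> nat \<Rightarrow> nat \<Rightarrow> bool" where
  "real_type g l e \<longleftrightarrow>
     g \<ge> 1 \<and> e \<in> {0, 1} \<and> l \<le> g \<and> (e = 1 \<longrightarrow> even l) \<and> (e = 0 \<longrightarrow> l \<ge> 1)"

definition M_core :: "nat \<Rightarrow> nat \<Rightarrow> int mat" where
  "M_core l e =
     (if e = 1
      then four_block_mat (0\<^sub>m (l div 2) (l div 2)) (1\<^sub>m (l div 2))
                          (1\<^sub>m (l div 2)) (0\<^sub>m (l div 2) (l div 2))
      else 1\<^sub>m l)"

definition M_mat :: "nat \<Rightarrow> nat \<Rightarrow> nat \<Rightarrow> int mat" where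
  "M_mat g l e =
     four_block_mat (M_core l e) (0\<^sub>m l (g - l)) (0\<^sub>m (g - l) l) (0\<^sub>m (g - l) (g - l))"

definition pos_def :: "nat \<Rightarrow> real mat \<Rightarrow> bool" where
  "pos_def g Y \<longleftrightarrow> Y \<in> carrier_mat g g \<and> Y\<^sup>T = Y \<and>
     (\<forall>x \<in> carrier_vec g. x \<noteq> 0\<^sub>v g \<longrightarrow> x \<bullet> (Y *\<^sub>v x) > 0)"

definition siegel :: "nat \<Rightarrow> complex mat set" where
  "siegel g = {\<tau> \<in> carrier_mat g g. \<tau>\<^sup>T = \<tau> \<and> pos_def g (map_mat Im \<tau>)}"

definition siegel_real :: "nat \<Rightarrow> nat \<Rightarrow> nat \<Rightarrow> complex mat set" where
  "siegel_real g l e = {\<tau> \<in> siegel g. 2 \<cdot>\<^sub>m map_mat Re \<tau> = map_mat of_int (M_mat g l e)}"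

definition GL_int :: "nat \<Rightarrow> int mat set" where
  "GL_int g = {A \<in> carrier_mat g g. invertible_mat A}"

definition cong_mat :: "nat \<Rightarrow> int mat \<Rightarrow> int mat \<Rightarrow> bool" where
  "cong_mat g P Q \<longleftrightarrow> (\<forall>i<g. \<forall>j<g. [P $$ (i, j) = Q $$ (i, j)] (mod 2))"

text \<open>Entrywise division by 2 rounds down; it is applied only to \<open>M - A M A\<^sup>T\<close> with
  \<open>M \<equiv> A M A\<^sup>T\<close> modulo 2, where it is exact.\<close>

definition half_mat :: "int mat \<Rightarrow> int mat" where
  "half_mat = map_mat (\<lambda>x. x div 2)"

definition defect :: "nat \<Rightarrow> nat \<Rightarrow> nat \<Rightarrow> int mat \<Rightarrow> int mat" where
  "defect g l e A = M_mat g l e - A * M_mat g l e * A\<^sup>T"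

text \<open>In the following set, \<open>D\<close> is the inverse of \<open>A\<^sup>T\<close>.\<close>

definition real_modular_group :: "nat \<Rightarrow> nat \<Rightarrow> nat \<Rightarrow> int mat set" where
  "real_modular_group g l e =
     {four_block_mat A (half_mat (defect g l e A) * D) (0\<^sub>m g g) D | A D.
        A \<in> GL_int g \<and> D \<in> carrier_mat g g \<and> inverts_mat (A\<^sup>T) D \<and> inverts_mat D (A\<^sup>T) \<and>
        cong_mat g (M_mat g l e) (A * M_mat g l e * A\<^sup>T)}"

text \<open>The block \<open>A\<close> of an element of the real modular group.\<close>

definition A_block :: "nat \<Rightarrow> int mat \<Rightarrow> int mat" where
  "A_block g G = mat g g (\<lambda>(i, j). G $$ (i, j))"

lemma A_block_four_block:
  assumes "A \<in> carrier_mat g g" "D \<in> carrier_mat g g"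
  shows "A_block g (four_block_mat A B C D) = A"
  using assms by (intro eq_matI) (auto simp: A_block_def)

definition M_act :: "nat \<Rightarrow> nat \<Rightarrow> nat \<Rightarrow> int mat \<Rightarrow> complex mat \<Rightarrow> complex mat" where
  "M_act g l e G \<tau> =
     (let A = A_block g G
      in map_mat of_int A * \<tau> * (map_mat of_int A)\<^sup>T
           + (1 / 2) \<cdot>\<^sub>m map_mat of_int (defect g l e A))"

text \<open>The group \<open>\<int>\<^sub>2\<^sup>g\<close> is \<^term>\<open>carrier_vec g :: bit vec set\<close>, and \<open>class2\<close> is the map
  \<open>\<beta> \<mapsto> [\<beta>]\<^sub>2\<close>.  The formula for \<open>A_act\<close> in terms of representatives is \<open>A_act_class2\<close>.\<close>

definition class2 :: "int vec \<Rightarrow> bit vec" where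
  "class2 \<beta> = map_vec of_int \<beta>"

lemma class2_eq_iff:
  assumes "\<beta> \<in> carrier_vec g" "\<gamma> \<in> carrier_vec g"
  shows "class2 \<beta> = class2 \<gamma> \<longleftrightarrow> (\<forall>i<g. [\<beta> $ i = \<gamma> $ i] (mod 2))"
proof -
  have *: "(of_int x :: bit) = of_int y \<longleftrightarrow> [x = y] (mod 2)" for x y
    by (cases "even x"; cases "even y")
       (auto simp: cong_def mod_2_eq_odd elim!: evenE oddE)
  show ?thesis
    using assms unfolding class2_def vec_eq_iff by (auto simp: *)
qed

definition half_diag :: "int mat \<Rightarrow> int vec" where
  "half_diag P = vec (dim_row P) (\<lambda>i. P $$ (i, i) div 2)"

definition A_act :: "nat \<Rightarrow> nat \<Rightarrow> nat \<Rightarrow> int mat \<Rightarrow> bit vec \<Rightarrow> bit vec" where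
  "A_act g l e G b =
     (let A = A_block g G
      in map_mat of_int A *\<^sub>v b - class2 (half_diag (defect g l e A)))"

lemma A_act_class2:
  assumes "\<beta> \<in> carrier_vec g"
  shows "A_act g l e G (class2 \<beta>) =
    class2 (A_block g G *\<^sub>v \<beta> - half_diag (defect g l e (A_block g G)))"
proof -
  let ?A = "A_block g G"
  have A: "?A \<in> carrier_mat g g" by (simp add: A_block_def)
  have d: "dim_vec (half_diag (defect g l e ?A)) = g"
    using A by (simp add: half_diag_def defect_def)
  have "class2 (?A *\<^sub>v \<beta>) = map_mat of_int ?A *\<^sub>v class2 \<beta>"
    unfolding class2_def using of_int_hom.mult_mat_vec_hom[OF A assms] .
  moreover have "class2 (u - v) = class2 u - class2 v" if "dim_vec u = dim_vec v" for u v
    using that by (intro eq_vecI) (auto simp: class2_def of_int_diff)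
  ultimately show ?thesis
    using A d by (simp add: A_act_def Let_def)
qed

text \<open>The theta constant with characteristic \<open>[0; \<beta>]\<close>; the sum is unconditional, and it
  converges for \<open>\<tau>\<close> in the Siegel upper half space.\<close>

definition theta :: "nat \<Rightarrow> int vec \<Rightarrow> complex mat \<Rightarrow> complex" where
  "theta g \<beta> \<tau> =
     (\<Sum>\<^sub>\<infinity>m \<in> carrier_vec g.
        exp (of_real pi * \<i> * (map_vec of_int m \<bullet> (\<tau> *\<^sub>v map_vec of_int m))
             + of_real pi * \<i> * of_int (\<beta> \<bullet> m)))"

end

theory Submission
  imports Defs
begin

text \<open>With \<open>N = (M - A M A\<^sup>T) / 2\<close>, a symmetric integer matrix, the exponent of the \<open>m\<close>-th term of
  the left-hand series is \<open>\<pi> \<i>\<close> times \<open>n\<^sup>T \<tau> n + m\<^sup>T N m + \<beta>'\<^sup>T m\<close> for \<open>n = A\<^sup>T m\<close>. Since \<open>N\<close> is symmetric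
  and \<open>m\<^sub>i\<^sup>2 \<equiv> m\<^sub>i\<close>, \<open>m\<^sup>T N m \<equiv> diag(N)\<^sup>T m\<close> modulo 2, which cancels the affine term of the action on
  characteristics and leaves the \<open>n\<close>-th term of the right-hand series; \<open>m \<mapsto> A\<^sup>T m\<close> permutes
  \<open>\<int>\<^sup>g\<close>, so the two sums are reindexings of each other.\<close>

text \<open>Off-diagonal entries pair up as \<open>f i j + f j i = 2 * f i j\<close>. The induction
  peels off the last row and column: they contribute twice the column \<open>f i n\<close> above the
  diagonal, while \<open>f n n\<close> cancels.\<close>

lemma even_sum_sym_minus_diag:
  fixes f :: "nat \<Rightarrow> nat \<Rightarrow> int"
  assumes "\<And>i j. i < n \<Longrightarrow> j < n \<Longrightarrow> f i j = f j i"
  shows "even ((\<Sum>i<n. \<Sum>j<n. f i j) - (\<Sum>i<n. f i i))"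
  using assms
proof (induction n)
  case (Suc n)
  have "(\<Sum>j<n. f n j) = (\<Sum>i<n. f i n)"
    using Suc.prems by (intro sum.cong) auto
  then have "(\<Sum>i<Suc n. \<Sum>j<Suc n. f i j) - (\<Sum>i<Suc n. f i i)
      = ((\<Sum>i<n. \<Sum>j<n. f i j) - (\<Sum>i<n. f i i)) + 2 * (\<Sum>i<n. f i n)"
    by (simp add: sum.distrib)
  then show ?case using Suc by simp
qed simp

lemma even_quadratic_form_minus_diag:
  fixes N :: "int mat"
  assumes N: "N \<in> carrier_mat g g" and m: "m \<in> carrier_vec g"
    and sym: "\<And>i j. i < g \<Longrightarrow> j < g \<Longrightarrow> N $$ (i, j) = N $$ (j, i)"
  shows "even (m \<bullet> (N *\<^sub>v m) - vec g (\<lambda>i. N $$ (i, i)) \<bullet> m)"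
proof -
  let ?f = "\<lambda>i j. m $ i * N $$ (i, j) * m $ j"
  have "m \<bullet> (N *\<^sub>v m) = (\<Sum>i<g. \<Sum>j<g. ?f i j)"
    using N m by (auto simp: scalar_prod_def sum_distrib_left mult.assoc atLeast0LessThan
        intro!: sum.cong)
  moreover have "vec g (\<lambda>i. N $$ (i, i)) \<bullet> m = (\<Sum>i<g. N $$ (i, i) * m $ i)"
    using m by (auto simp: scalar_prod_def atLeast0LessThan)
  moreover have "even ((\<Sum>i<g. \<Sum>j<g. ?f i j) - (\<Sum>i<g. ?f i i))"
    by (rule even_sum_sym_minus_diag) (auto simp: sym)
  \<comment> \<open>Termwise, the difference is \<open>N $$ (i, i)\<close> times
    \<open>m $ i * (m $ i - 1)\<close>, a product of consecutive integers.\<close>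
  moreover have "even ((\<Sum>i<g. ?f i i) - (\<Sum>i<g. N $$ (i, i) * m $ i))"
    unfolding sum_subtractf[symmetric] by (rule dvd_sum) auto
  ultimately show ?thesis by auto
qed

text \<open>Allows a characteristic to be exchanged for another representative of its class at the
  cost of an even integer in the exponent.\<close>

lemma even_scalar_prod_diff:
  assumes "u \<in> carrier_vec g" "v \<in> carrier_vec g" "m \<in> carrier_vec g"
    and "class2 u = class2 v"
  shows "even (u \<bullet> m - v \<bullet> m)"
proof -
  have "u \<bullet> m - v \<bullet> m = (\<Sum>i<g. (u $ i - v $ i) * m $ i)"
    using assms(1-3)
    by (simp add: scalar_prod_def sum_subtractf algebra_simps atLeast0LessThan)
  moreover have "even (u $ i - v $ i)" if "i < g" for i
    using assms that by (auto simp: class2_eq_iff cong_iff_dvd_diff)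
  ultimately show ?thesis by (auto intro!: dvd_sum)
qed

lemma of_int_scalar_prod:
  assumes "dim_vec u = dim_vec v"
  shows "(of_int (u \<bullet> v) :: 'a :: comm_ring_1) = map_vec of_int u \<bullet> map_vec of_int v"
  using assms by (simp add: scalar_prod_def)

text \<open>With \<open>k = 2 * r\<close> the exponents differ by \<open>r\<close> periods of exp;
  this is how even integers get discarded.\<close>

lemma exp_pi_i_cong_even:
  assumes "x - y = of_int k" "even k"
  shows "exp (of_real pi * \<i> * x) = exp (of_real pi * \<i> * y)"
proof -
  from \<open>even k\<close> obtain r where k: "k = 2 * r" by (rule evenE)
  have "x = y + 2 * of_int r" using assms(1) k by (simp add: algebra_simps)
  then have "of_real pi * \<i> * x = of_real pi * \<i> * y + of_int r * (2 * of_real pi * \<i>)"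
    by (simp add: algebra_simps)
  moreover have "exp (of_int r * (2 * of_real pi * \<i>)) = 1"
    by (simp flip: exp_power_int)
  ultimately show ?thesis by (simp only: exp_add mult_1_right)
qed

text \<open>The outer factor \<open>A\<close> moves across the scalar product as its adjoint
  \<open>A\<^sup>T\<close>.\<close>

lemma quadratic_form_congruence:
  fixes \<tau> :: "'a :: comm_ring_1 mat"
  assumes "A \<in> carrier_mat g g" "\<tau> \<in> carrier_mat g g" "x \<in> carrier_vec g"
  shows "x \<bullet> ((A * \<tau> * A\<^sup>T) *\<^sub>v x) = (A\<^sup>T *\<^sub>v x) \<bullet> (\<tau> *\<^sub>v (A\<^sup>T *\<^sub>v x))"
proof -
  have At: "A\<^sup>T \<in> carrier_mat g g" using assms by simp
  let ?y = "A\<^sup>T *\<^sub>v x"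
  have y: "?y \<in> carrier_vec g" "\<tau> *\<^sub>v ?y \<in> carrier_vec g"
    using mult_mat_vec_carrier[OF At assms(3)] mult_mat_vec_carrier[OF assms(2)] by auto
  have "(A * \<tau> * A\<^sup>T) *\<^sub>v x = A *\<^sub>v (\<tau> *\<^sub>v ?y)"
    using assoc_mult_mat_vec[OF mult_carrier_mat[OF assms(1,2)] At assms(3)]
      assoc_mult_mat_vec[OF assms(1,2) y(1)] by simp
  then show ?thesis
    using transpose_vec_mult_scalar[OF assms(1) y(2) assms(3)]
    by simp
qed

lemma bij_betw_mult_mat_vec:
  fixes B D :: "'a :: comm_ring_1 mat"
  assumes B: "B \<in> carrier_mat g g" and D: "D \<in> carrier_mat g g"
    and "inverts_mat B D" "inverts_mat D B"
  shows "bij_betw ((*\<^sub>v) B) (carrier_vec g) (carrier_vec g)"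
proof -
  have "B * D = 1\<^sub>m g" "D * B = 1\<^sub>m g"
    using assms by (auto simp: inverts_mat_def)
  then show ?thesis
    using B D by (intro bij_betw_byWitness[where f' = "(*\<^sub>v) D"])
      (auto simp flip: assoc_mult_mat_vec)
qed

text \<open>Shape and symmetry of M are inherited from \<tau> through 2 Re \<tau> = M, which avoids
  a case analysis on the block definition.\<close>

lemma siegel_real_M_mat:
  assumes "\<tau> \<in> siegel_real g l e"
  shows "M_mat g l e \<in> carrier_mat g g" "(M_mat g l e)\<^sup>T = M_mat g l e"
proof -
  let ?M = "M_mat g l e"
  have \<tau>: "\<tau> \<in> carrier_mat g g" "\<tau>\<^sup>T = \<tau>"
    and eq: "2 \<cdot>\<^sub>m map_mat Re \<tau> = map_mat of_int ?M"
    using assms by (auto simp: siegel_real_def siegel_def)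
  from arg_cong[OF eq, of dim_row] arg_cong[OF eq, of dim_col] \<tau>(1)
  show M: "?M \<in> carrier_mat g g" by auto
  show "?M\<^sup>T = ?M"
  proof (intro eq_matI)
    fix i j assume "i < dim_row ?M" "j < dim_col ?M"
    then have ij: "i < g" "j < g" using M by auto
    have entry: "real_of_int (?M $$ (a, b)) = 2 * Re (\<tau> $$ (a, b))" if "a < g" "b < g" for a b
      using arg_cong[OF eq, of "\<lambda>X. X $$ (a, b)"] that M \<tau>(1) by simp
    have "\<tau> $$ (i, j) = \<tau> $$ (j, i)"
      using \<tau> ij by (metis carrier_matD index_transpose_mat(1))
    then have "real_of_int (?M $$ (j, i)) = of_int (?M $$ (i, j))" using entry ij by simp
    then show "?M\<^sup>T $$ (i, j) = ?M $$ (i, j)" using M ij by simp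
  qed (use M in auto)
qed

lemma defect_sym:
  assumes M: "M_mat g l e \<in> carrier_mat g g" "(M_mat g l e)\<^sup>T = M_mat g l e"
    and A: "A \<in> carrier_mat g g"
  shows "defect g l e A \<in> carrier_mat g g" "(defect g l e A)\<^sup>T = defect g l e A"
proof -
  let ?M = "M_mat g l e"
  have At: "A\<^sup>T \<in> carrier_mat g g" using A by simp
  have AMA: "A * ?M * A\<^sup>T \<in> carrier_mat g g" using A At M by auto
  then show D: "defect g l e A \<in> carrier_mat g g" unfolding defect_def by (rule minus_carrier_mat)
  have "(A * ?M * A\<^sup>T)\<^sup>T = A * ?M * A\<^sup>T"
    using transpose_mult[OF mult_carrier_mat[OF A M(1)] At] transpose_mult[OF A M(1)]
      assoc_mult_mat[OF A M(1) At] M(2) by simp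
  then show "(defect g l e A)\<^sup>T = defect g l e A"
    using transpose_minus[OF M(1) AMA] M(2) by (simp add: defect_def)
qed

text \<open>Reconciles the two halvings: the action on \<tau> multiplies by the complex number 1/2,
  while the parity argument needs the integer matrix obtained with \<open>div\<close>. They agree
  because the congruence modulo 2 makes every entry of the defect even.\<close>

lemma half_defect:
  assumes "defect g l e A \<in> carrier_mat g g" "M_mat g l e \<in> carrier_mat g g"
    and "A \<in> carrier_mat g g"
    and cong: "cong_mat g (M_mat g l e) (A * M_mat g l e * A\<^sup>T)"
  shows "(1 / 2 :: complex) \<cdot>\<^sub>m map_mat of_int (defect g l e A)
       = map_mat of_int (half_mat (defect g l e A))"
proof (intro eq_matI)
  let ?D = "defect g l e A"
  fix i j assume "i < dim_row (map_mat of_int (half_mat ?D) :: complex mat)"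
    "j < dim_col (map_mat of_int (half_mat ?D) :: complex mat)"
  then have ij: "i < g" "j < g" using assms(1) by (auto simp: half_mat_def)
  have "?D $$ (i, j) = M_mat g l e $$ (i, j) - (A * M_mat g l e * A\<^sup>T) $$ (i, j)"
    using assms(2,3) ij by (simp add: defect_def)
  then have "even (?D $$ (i, j))"
    using cong ij by (auto simp: cong_mat_def cong_iff_dvd_diff)
  then obtain r where "?D $$ (i, j) = 2 * r" by (rule evenE)
  then show "((1 / 2 :: complex) \<cdot>\<^sub>m map_mat of_int ?D) $$ (i, j)
      = map_mat of_int (half_mat ?D) $$ (i, j)"
    using assms(1) ij by (simp add: half_mat_def)
qed (use assms(1) in \<open>auto simp: half_mat_def\<close>)

theorem theorem1p1:
  fixes g l e :: nat
    and \<beta> \<beta>' :: "int vec"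
    and \<tau> \<tau>' :: "complex mat"
  assumes "real_type g l e"
    and "\<beta> \<in> carrier_vec g" and "\<beta>' \<in> carrier_vec g"
    and "\<tau> \<in> siegel_real g l e" and "\<tau>' \<in> siegel_real g l e"
    and "\<exists>G \<in> real_modular_group g l e.
           \<tau>' = M_act g l e G \<tau> \<and> class2 \<beta>' = A_act g l e G (class2 \<beta>)"
  shows "theta g \<beta>' \<tau>' = theta g \<beta> \<tau>"
proof -
  \<comment> \<open>\<open>A_act_class2\<close> replaces the action on bit vectors by an integer
    representative; \<open>D\<close> serves as the inverse that makes m \<mapsto>
    \<open>A\<^sup>T *\<^sub>v m\<close> a bijection.\<close>
  obtain A D where A: "A \<in> carrier_mat g g" and D: "D \<in> carrier_mat g g"
    and inv: "inverts_mat (A\<^sup>T) D" "inverts_mat D (A\<^sup>T)"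
    and cong: "cong_mat g (M_mat g l e) (A * M_mat g l e * A\<^sup>T)"
    and \<tau>': "\<tau>' = map_mat of_int A * \<tau> * (map_mat of_int A)\<^sup>T
           + (1 / 2) \<cdot>\<^sub>m map_mat of_int (defect g l e A)"
    and \<beta>': "class2 \<beta>' = class2 (A *\<^sub>v \<beta> - half_diag (defect g l e A))"
    using assms(6) unfolding real_modular_group_def GL_int_def M_act_def
    by (auto simp: A_act_class2[OF assms(2)] A_block_four_block Let_def)
  let ?N = "half_mat (defect g l e A)" and ?d = "half_diag (defect g l e A)"
  note M = siegel_real_M_mat[OF assms(4)]
  note E = defect_sym[OF M A]
  have N: "?N \<in> carrier_mat g g" using E(1) by (simp add: half_mat_def)
  have sym: "?N $$ (i, j) = ?N $$ (j, i)" if "i < g" "j < g" for i j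
    using E that by (simp add: half_mat_def) (metis carrier_matD index_transpose_mat(1))
  \<comment> \<open>The shift in the action on characteristics is exactly the diagonal of
    \<open>?N\<close>, the vector that the parity lemma for quadratic forms produces.\<close>
  have d: "?d \<in> carrier_vec g" "?d = vec g (\<lambda>i. ?N $$ (i, i))"
    using E(1) by (auto simp: half_diag_def half_mat_def)
  have \<tau>: "\<tau> \<in> carrier_mat g g" using assms(4) by (auto simp: siegel_real_def siegel_def)
  let ?c = "map_vec of_int :: int vec \<Rightarrow> complex vec"
  let ?C = "map_mat of_int :: int mat \<Rightarrow> complex mat"
  let ?t = "\<lambda>\<beta> \<tau> m. exp (of_real pi * \<i> * (?c m \<bullet> (\<tau> *\<^sub>v ?c m))
             + of_real pi * \<i> * of_int (\<beta> \<bullet> m))"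
  have "?t \<beta>' \<tau>' m = ?t \<beta> \<tau> (A\<^sup>T *\<^sub>v m)" if m: "m \<in> carrier_vec g" for m
  proof -
    have At: "A\<^sup>T \<in> carrier_mat g g" and CA: "?C A \<in> carrier_mat g g"
      and CN: "?C ?N \<in> carrier_mat g g" and cm: "?c m \<in> carrier_vec g"
      using A N m by auto
    have ATm: "?c (A\<^sup>T *\<^sub>v m) = (?C A)\<^sup>T *\<^sub>v ?c m"
      using of_int_hom.mult_mat_vec_hom[OF At m, where 'a = complex] by (simp add: map_mat_transpose)
    have P: "?C A * \<tau> * (?C A)\<^sup>T \<in> carrier_mat g g" using CA \<tau> by auto
    have Nm: "?c m \<bullet> (?C ?N *\<^sub>v ?c m) = of_int (m \<bullet> (?N *\<^sub>v m))"
      unfolding of_int_hom.mult_mat_vec_hom[OF N m, symmetric]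
      using N m by (intro of_int_scalar_prod[symmetric]) auto
    have "?c m \<bullet> (\<tau>' *\<^sub>v ?c m)
        = ?c m \<bullet> ((?C A * \<tau> * (?C A)\<^sup>T) *\<^sub>v ?c m) + ?c m \<bullet> (?C ?N *\<^sub>v ?c m)"
      unfolding \<tau>' half_defect[OF E(1) M(1) A cong]
        add_mult_distrib_mat_vec[OF P CN cm]
      by (rule scalar_prod_add_distrib[OF cm mult_mat_vec_carrier[OF P cm]
            mult_mat_vec_carrier[OF CN cm]])
    then have quad: "?c m \<bullet> (\<tau>' *\<^sub>v ?c m)
        = ?c (A\<^sup>T *\<^sub>v m) \<bullet> (\<tau> *\<^sub>v ?c (A\<^sup>T *\<^sub>v m)) + of_int (m \<bullet> (?N *\<^sub>v m))"
      unfolding quadratic_form_congruence[OF CA \<tau> cm] ATm Nm .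
    have Ab: "A *\<^sub>v \<beta> \<in> carrier_vec g" using A assms(2) by auto
    have "(A *\<^sub>v \<beta>) \<bullet> m = \<beta> \<bullet> (A\<^sup>T *\<^sub>v m)"
      using transpose_vec_mult_scalar[OF At m assms(2)] by simp
    then have lin: "(A *\<^sub>v \<beta> - ?d) \<bullet> m = \<beta> \<bullet> (A\<^sup>T *\<^sub>v m) - ?d \<bullet> m"
      using minus_scalar_prod_distrib[OF Ab d(1) m] by simp
    have "even (m \<bullet> (?N *\<^sub>v m) - ?d \<bullet> m)"
      using even_quadratic_form_minus_diag[OF N m sym] d(2) by simp
    moreover have "even (\<beta>' \<bullet> m - (\<beta> \<bullet> (A\<^sup>T *\<^sub>v m) - ?d \<bullet> m))"
      using even_scalar_prod_diff[OF assms(3) _ m \<beta>'] Ab d(1) lin by auto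
    \<comment> \<open>In the sum of the two even numbers the terms \<open>?d \<bullet> m\<close>
      cancel.\<close>
    ultimately have ev: "even (m \<bullet> (?N *\<^sub>v m) + \<beta>' \<bullet> m - \<beta> \<bullet> (A\<^sup>T *\<^sub>v m))"
      by auto
    show ?thesis
      \<comment> \<open>The quadratic and linear parts are collected under one factor \<pi> i; the
        part quadratic in \<open>A\<^sup>T *\<^sub>v m\<close> is common to both exponents, so they
        differ by \<pi> i times the integer in \<open>ev\<close>.\<close>
      unfolding distrib_left[symmetric] quad
      by (rule exp_pi_i_cong_even[OF _ ev]) simp
  qed
  then have "theta g \<beta>' \<tau>' = (\<Sum>\<^sub>\<infinity>m \<in> carrier_vec g. ?t \<beta> \<tau> (A\<^sup>T *\<^sub>v m))"
    unfolding theta_def by (rule infsum_cong)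
  \<comment> \<open>Reindexing \<open>infsum\<close> along a bijection is valid regardless of
    summability, since a divergent sum has the default value 0 on both sides.\<close>
  also have "\<dots> = theta g \<beta> \<tau>"
    unfolding theta_def
    by (rule infsum_reindex_bij_betw[where f = "?t \<beta> \<tau>", OF bij_betw_mult_mat_vec[OF _ D inv]])
      (use A in simp)
  finally show ?thesis .
qed

end
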